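(* Let $\mathbf A=(a_{ij})\in\mathcal A$ be a pairwise comparison matrix of order $n$, let $\alpha>0$, and define the cost matrix $\mathbf C=(c_{ij})$ by $c_{ij}=-\alpha\log a_{ij}$. Consider the entropy-regularized optimal transport problem with unit marginals $$\text{minimize}\ \sum_{i=1}^n\sum_{j=1}^n\bigl(c_{ij}x_{ij}+\alpha\,x_{ij}\log x_{ij}\bigr)$$ over matrices $\mathbf X=(x_{ij})\in\mathbb R^{n\times n}$ with strictly positive entries, subject to $\sum_{j=1}^n x_{ij}=1$ for all $i$ and $\sum_{i=1}^n x_{ij}=1$ for all $j$. Then the solution (minimizer) $\mathbf X_\alpha$ of this problem coincides with the doubly stochastic matrix obtained from the Sinkhorn scaling of $\mathbf A$, that is, $\mathbf X_\alpha=\mathbf S=\mathbf D_1\mathbf A\mathbf D_2$.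
   Context: $\mathcal A$ is the set of pairwise comparison matrices: real $n\times n$ matrices $\mathbf A=(a_{ij})$ with positive entries such that $a_{ii}=1$ for all $i$ and $a_{ij}=1/a_{ji}$ for all $i,j$. Sinkhorn scaling: by Sinkhorn's theorem, for every $n\times n$ matrix $\mathbf A$ with positive entries there exist diagonal matrices $\mathbf D_1,\mathbf D_2$ with strictly positive diagonal entries such that $\mathbf S=\mathbf D_1\mathbf A\mathbf D_2$ is doubly stochastic (nonnegative entries, all row and column sums equal to $1$). The matrix $\mathbf S$ is unique, and the pair $(\mathbf D_1,\mathbf D_2)$ is unique up to replacement by $(c\mathbf D_1,c^{-1}\mathbf D_2)$ with $c>0$. The factorization $\mathbf S=\mathbf D_1\mathbf A\mathbf D_2$ is called the Sinkhorn scaling of $\mathbf A$. *)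

theory Defs
  imports "HOL-Analysis.Analysis"
begin

definition pairwise_comparison_matrices :: "(real^'n^'n) set" where
  "pairwise_comparison_matrices =
     {A. (\<forall>i j. A $ i $ j > 0) \<and> (\<forall>i. A $ i $ i = 1) \<and> (\<forall>i j. A $ i $ j = 1 / A $ j $ i)}"

definition positive_diagonal_matrix :: "real^'n^'n \<Rightarrow> bool" where
  "positive_diagonal_matrix D \<longleftrightarrow>
     (\<forall>i j. i \<noteq> j \<longrightarrow> D $ i $ j = 0) \<and> (\<forall>i. D $ i $ i > 0)"

definition unit_marginals :: "real^'n^'n \<Rightarrow> bool" where
  "unit_marginals X \<longleftrightarrow>
     (\<forall>i. (\<Sum>j\<in>UNIV. X $ i $ j) = 1) \<and> (\<forall>j. (\<Sum>i\<in>UNIV. X $ i $ j) = 1)"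

definition doubly_stochastic :: "real^'n^'n \<Rightarrow> bool" where
  "doubly_stochastic S \<longleftrightarrow> (\<forall>i j. S $ i $ j \<ge> 0) \<and> unit_marginals S"

definition sinkhorn_scaling ::
    "real^'n^'n \<Rightarrow> real^'n^'n \<Rightarrow> real^'n^'n \<Rightarrow> real^'n^'n \<Rightarrow> bool" where
  "sinkhorn_scaling A D1 D2 S \<longleftrightarrow>
     positive_diagonal_matrix D1 \<and> positive_diagonal_matrix D2 \<and>
     S = D1 ** A ** D2 \<and> doubly_stochastic S"

definition entropic_ot_cost :: "real \<Rightarrow> real^'n^'n \<Rightarrow> real^'n^'n \<Rightarrow> real" where
  "entropic_ot_cost \<alpha> C X =
     (\<Sum>i\<in>UNIV. \<Sum>j\<in>UNIV. C $ i $ j * X $ i $ j + \<alpha> * (X $ i $ j * ln (X $ i $ j)))"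

definition entropic_ot_feasible :: "real^'n^'n \<Rightarrow> bool" where
  "entropic_ot_feasible X \<longleftrightarrow> (\<forall>i j. X $ i $ j > 0) \<and> unit_marginals X"

definition entropic_ot_solution :: "real \<Rightarrow> real^'n^'n \<Rightarrow> real^'n^'n \<Rightarrow> bool" where
  "entropic_ot_solution \<alpha> C X \<longleftrightarrow> is_arg_min (entropic_ot_cost \<alpha> C) entropic_ot_feasible X"

end

theory Submission
  imports Defs
begin

text \<open>
  Existence: for positive \<open>x\<close> put \<open>p = 1 / (A x)\<close> entrywise. The matrix with entries
  \<open>p\<^sub>i a\<^sub>i\<^sub>j x\<^sub>j\<close> has unit row sums, and it has unit column sums iff \<open>x\<close> is a fixed point of
  \<open>x \<mapsto> 1 / (A\<^sup>T (1 / (A x)))\<close>. Normalised, this map is a continuous self-map of the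
  simplex, so Brouwer yields a fixed point up to a factor, and the factor is \<open>1\<close> because the
  entries of the matrix sum to \<open>n\<close>.

  Optimality: \<open>ln (s\<^sub>i\<^sub>j / a\<^sub>i\<^sub>j)\<close> splits as \<open>ln p\<^sub>i + ln q\<^sub>j\<close>, so its integral against any feasible
  matrix is the same. Hence the excess cost of a feasible \<open>X\<close> over \<open>S\<close> is \<open>\<alpha>\<close> times the
  relative entropy of \<open>X\<close> with respect to \<open>S\<close>.
\<close>

lemma diagonal_matrix_mult_nth:
  fixes D1 A D2 :: "real^'n^'n"
  assumes "\<And>i j. i \<noteq> j \<Longrightarrow> D1 $ i $ j = 0" "\<And>i j. i \<noteq> j \<Longrightarrow> D2 $ i $ j = 0"
  shows "(D1 ** A ** D2) $ i $ j = D1 $ i $ i * A $ i $ j * D2 $ j $ j"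
proof -
  have left: "(D1 ** A) $ i $ k = D1 $ i $ i * A $ i $ k" for k
  proof -
    have "(D1 ** A) $ i $ k = (\<Sum>l\<in>UNIV. if l = i then D1 $ i $ i * A $ i $ k else 0)"
      unfolding matrix_matrix_mult_def vec_lambda_beta
      using assms(1) by (intro sum.cong) auto
    then show ?thesis by simp
  qed
  have "(D1 ** A ** D2) $ i $ j
      = (\<Sum>k\<in>UNIV. if k = j then D1 $ i $ i * A $ i $ j * D2 $ j $ j else 0)"
    unfolding matrix_matrix_mult_def[of "D1 ** A"] vec_lambda_beta
    using assms(2) left by (intro sum.cong) auto
  then show ?thesis by simp
qed

text \<open>Domain for Brouwer's theorem. Zero coordinates are allowed for the sake of compactness;
  the fixed point turns out to be strictly positive.\<close>

definition prob_simplex :: "(real^'n) set" where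
  "prob_simplex = {x. (\<forall>i. 0 \<le> x $ i) \<and> (\<Sum>i\<in>UNIV. x $ i) = 1}"

lemma compact_prob_simplex: "compact (prob_simplex :: (real^'n) set)"
proof -
  have "x $ i \<le> 1" if "x \<in> prob_simplex" for x :: "real^'n" and i
    using that member_le_sum[of i UNIV "\<lambda>i. x $ i"] by (simp add: prob_simplex_def)
  then have "prob_simplex \<subseteq> cbox (0 :: real^'n) 1"
    by (auto simp: mem_box_cart prob_simplex_def)
  moreover have "closed (prob_simplex :: (real^'n) set)"
    unfolding prob_simplex_def
    by (intro closed_Collect_conj closed_Collect_all closed_Collect_le closed_Collect_eq
        continuous_intros)
  ultimately show ?thesis
    using bounded_cbox bounded_subset compact_eq_bounded_closed by blast
qed

lemma convex_prob_simplex: "convex (prob_simplex :: (real^'n) set)"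
  unfolding convex_def prob_simplex_def
  by (auto simp: sum.distrib simp flip: sum_distrib_left)

lemma prob_simplex_nonempty: "(prob_simplex :: (real^'n) set) \<noteq> {}"
proof -
  have "(\<chi> i. 1 / real CARD('n)) \<in> (prob_simplex :: (real^'n) set)"
    unfolding prob_simplex_def by simp
  then show ?thesis by blast
qed

text \<open>One positive coordinate of \<open>x\<close> already contributes a positive term to every
  coordinate of the product. Boundary points of the simplex are thus covered, and the reciprocals
  taken in the scaling map are well behaved there.\<close>

lemma matrix_vector_mult_pos:
  fixes A :: "real^'n^'m"
  assumes "\<And>i j. A $ i $ j > 0" "\<And>i. x $ i \<ge> 0" "x \<noteq> 0"
  shows "(A *v x) $ i > 0"
proof -
  obtain k where "x $ k \<noteq> 0" using assms(3) by (auto simp: vec_eq_iff)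
  then have "0 < A $ i $ k * x $ k" using assms(1)[of i k] assms(2)[of k] by simp
  then have "0 < (\<Sum>j\<in>UNIV. A $ i $ j * x $ j)"
    using assms(1,2) by (intro sum_pos2[of _ k]) (auto simp: less_imp_le)
  then show ?thesis by (simp add: matrix_vector_mult_def)
qed

text \<open>Sinkhorn's theorem in vector form: \<open>p\<close> and \<open>q\<close> become the
  diagonals of the two scaling matrices. Here \<open>q\<close> is a Brouwer fixed point
  \<open>x\<close> and \<open>p\<close> is \<open>P x\<close>.\<close>

lemma positive_matrix_scaling_vectors:
  fixes A :: "real^'n^'n"
  assumes pos: "\<And>i j. A $ i $ j > 0"
  obtains p q :: "real^'n" where "\<And>i. p $ i > 0" "\<And>i. q $ i > 0"
    "\<And>i. (\<Sum>j\<in>UNIV. p $ i * A $ i $ j * q $ j) = 1"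
    "\<And>j. (\<Sum>i\<in>UNIV. p $ i * A $ i $ j * q $ j) = 1"
proof -
  \<comment> \<open>One sweep of Sinkhorn's alternating normalisation: \<open>P x\<close> is the row
    scaling that fits the column scaling \<open>x\<close>, and \<open>T x\<close> is the column
    scaling that fits \<open>P x\<close>. The factor \<open>s x\<close> brings \<open>T x\<close>
    back into the simplex.\<close>
  define P :: "real^'n \<Rightarrow> real^'n" where "P x = (\<chi> i. 1 / (A *v x) $ i)" for x
  define T :: "real^'n \<Rightarrow> real^'n" where "T x = (\<chi> i. 1 / (transpose A *v P x) $ i)" for x
  define s where "s x = (\<Sum>i\<in>UNIV. T x $ i)" for x
  have tpos: "transpose A $ i $ j > 0" for i j using pos by (simp add: transpose_def)
  have Ax: "(A *v x) $ i > 0" if "x \<in> prob_simplex" for x i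
    using that by (intro matrix_vector_mult_pos pos) (auto simp: prob_simplex_def)
  then have Px: "P x $ i > 0" if "x \<in> prob_simplex" for x i
    using that by (simp add: P_def)
  have AtPx: "(transpose A *v P x) $ i > 0" if "x \<in> prob_simplex" for x i
  proof (rule matrix_vector_mult_pos[OF tpos])
    show "P x $ i \<ge> 0" for i using Px[OF that] by (simp add: less_imp_le)
    show "P x \<noteq> 0" using Px[OF that] by (metis less_irrefl zero_index)
  qed
  then have Tx: "T x $ i > 0" if "x \<in> prob_simplex" for x i
    using that by (simp add: T_def)
  then have sx: "s x > 0" if "x \<in> prob_simplex" for x
    using that unfolding s_def by (intro sum_pos) auto
  have contP: "continuous_on prob_simplex P"
    unfolding P_def using Ax
    by (intro continuous_on_vec_lambda continuous_on_divide continuous_on_const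
        continuous_on_component matrix_vector_mult_linear_continuous_on ballI less_imp_neq[symmetric])
  have contT: "continuous_on prob_simplex T"
    unfolding T_def using AtPx
    by (intro continuous_on_vec_lambda continuous_on_divide continuous_on_const
        continuous_on_component bounded_linear.continuous_on[OF matrix_vector_mul_bounded_linear]
        contP ballI less_imp_neq[symmetric])
  have "continuous_on prob_simplex (\<lambda>x. (1 / s x) *\<^sub>R T x)"
    using sx contT unfolding s_def
    by (intro continuous_on_scaleR continuous_on_divide continuous_on_const continuous_on_sum
        continuous_on_component ballI less_imp_neq[symmetric])
  moreover have "(\<lambda>x. (1 / s x) *\<^sub>R T x) \<in> prob_simplex \<rightarrow> prob_simplex"
  proof
    fix x :: "real^'n" assume x: "x \<in> prob_simplex"
    have "(\<Sum>i\<in>UNIV. 1 / s x * T x $ i) = 1"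
      using sx[OF x] by (simp add: s_def flip: sum_divide_distrib)
    then show "(1 / s x) *\<^sub>R T x \<in> prob_simplex"
      using sx[OF x] Tx[OF x] by (simp add: prob_simplex_def less_imp_le)
  qed
  ultimately obtain x where x: "x \<in> prob_simplex" and eq: "(1 / s x) *\<^sub>R T x = x"
    by (rule brouwer[OF compact_prob_simplex convex_prob_simplex prob_simplex_nonempty])
  have xT: "x $ i = T x $ i / s x" for i
    using arg_cong[OF eq, of "\<lambda>y. y $ i"] by simp
  have row: "(\<Sum>j\<in>UNIV. P x $ i * A $ i $ j * x $ j) = 1" for i
  proof -
    have "(\<Sum>j\<in>UNIV. P x $ i * A $ i $ j * x $ j) = P x $ i * (A *v x) $ i"
      by (simp add: matrix_vector_mult_def sum_distrib_left mult.assoc)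
    then show ?thesis using Ax[OF x, of i] by (simp add: P_def)
  qed
  \<comment> \<open>Column scaling by \<open>T x\<close> would give sums exactly 1; \<open>x\<close>
    differs from it by the factor \<open>1 / s x\<close>, the same for all columns.\<close>
  have col: "(\<Sum>i\<in>UNIV. P x $ i * A $ i $ j * x $ j) = 1 / s x" for j
  proof -
    have "(\<Sum>i\<in>UNIV. P x $ i * A $ i $ j * x $ j) = (transpose A *v P x) $ j * x $ j"
      by (simp add: matrix_vector_mult_def transpose_def sum_distrib_left mult.commute)
    also have "\<dots> = (transpose A *v P x) $ j * (T x $ j / s x)" using xT by simp
    also have "\<dots> = 1 / s x" using AtPx[OF x, of j] by (simp add: T_def)
    finally show ?thesis .
  qed
  have "real CARD('n) = (\<Sum>i\<in>UNIV. \<Sum>j\<in>UNIV. P x $ i * A $ i $ j * x $ j)"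
    by (simp add: row)
  also have "\<dots> = (\<Sum>j\<in>UNIV. \<Sum>i\<in>UNIV. P x $ i * A $ i $ j * x $ j)"
    by (rule sum.swap)
  also have "\<dots> = real CARD('n) * (1 / s x)" by (simp add: col)
  finally have "s x = 1" using sx[OF x] by (simp add: field_simps)
  show thesis
  proof (rule that)
    show "P x $ i > 0" for i by (rule Px[OF x])
    \<comment> \<open>Membership in the simplex gives only nonnegativity; strictness comes from
      \<open>x\<close> being a positive multiple of \<open>T x\<close>.\<close>
    show "x $ i > 0" for i using xT[of i] Tx[OF x, of i] sx[OF x] by simp
    show "(\<Sum>i\<in>UNIV. P x $ i * A $ i $ j * x $ j) = 1" for j using col \<open>s x = 1\<close> by simp
  qed (rule row)
qed

theorem sinkhorn_scaling_exists:
  fixes A :: "real^'n^'n"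
  assumes "\<And>i j. A $ i $ j > 0"
  shows "\<exists>D1 D2 S. sinkhorn_scaling A D1 D2 S"
proof -
  obtain p q :: "real^'n" where p: "\<And>i. p $ i > 0" and q: "\<And>i. q $ i > 0"
    and row: "\<And>i. (\<Sum>j\<in>UNIV. p $ i * A $ i $ j * q $ j) = 1"
    and col: "\<And>j. (\<Sum>i\<in>UNIV. p $ i * A $ i $ j * q $ j) = 1"
    by (rule positive_matrix_scaling_vectors[OF assms]) blast
  define D where "D v = (\<chi> i j. if i = j then v $ i else 0)" for v :: "real^'n"
  have nth: "(D p ** A ** D q) $ i $ j = p $ i * A $ i $ j * q $ j" for i j
    by (subst diagonal_matrix_mult_nth) (auto simp: D_def)
  have "sinkhorn_scaling A (D p) (D q) (D p ** A ** D q)"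
    using p q row col assms
    unfolding sinkhorn_scaling_def doubly_stochastic_def unit_marginals_def
      positive_diagonal_matrix_def nth
    by (simp add: D_def less_imp_le)
  then show ?thesis by blast
qed

text \<open>With \<open>t = s / x\<close> the term is \<open>x * (t - 1 - ln t)\<close>, and
  \<open>ln t \<le> t - 1\<close> with equality only at \<open>t = 1\<close>. The correction
  \<open>- x + s\<close> makes every single term nonnegative, and it cancels in sums over matrices
  of equal total mass.\<close>

lemma relative_entropy_term_nonneg:
  fixes x s :: real
  assumes "x > 0" "s > 0"
  shows "0 \<le> x * (ln x - ln s) - x + s"
    and "x * (ln x - ln s) - x + s = 0 \<Longrightarrow> x = s"
proof -
  have *: "x * (ln x - ln s) - x + s = x * (s / x - 1 - ln (s / x))"
    using assms by (simp add: ln_div field_simps)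
  show "0 \<le> x * (ln x - ln s) - x + s"
    unfolding * using assms ln_le_minus_one[of "s / x"] by simp
  show "x = s" if "x * (ln x - ln s) - x + s = 0"
    using that assms ln_eq_minus_one[of "s / x"] unfolding * by simp
qed

text \<open>Each summand depends on one index only, so summing over the other index first leaves a
  marginal of \<open>X\<close>, which is 1.\<close>

lemma sum_additive_unit_marginals:
  fixes X :: "real^'n^'n"
  assumes "unit_marginals X"
  shows "(\<Sum>i\<in>UNIV. \<Sum>j\<in>UNIV. X $ i $ j * (f i + g j)) = (\<Sum>i\<in>UNIV. f i) + (\<Sum>j\<in>UNIV. g j)"
proof -
  have "(\<Sum>i\<in>UNIV. \<Sum>j\<in>UNIV. X $ i $ j * (f i + g j))
      = (\<Sum>i\<in>UNIV. (\<Sum>j\<in>UNIV. X $ i $ j) * f i) + (\<Sum>i\<in>UNIV. \<Sum>j\<in>UNIV. X $ i $ j * g j)"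
    by (simp add: distrib_left sum.distrib sum_distrib_right)
  also have "(\<Sum>i\<in>UNIV. \<Sum>j\<in>UNIV. X $ i $ j * g j) = (\<Sum>j\<in>UNIV. (\<Sum>i\<in>UNIV. X $ i $ j) * g j)"
    by (subst sum.swap) (simp add: sum_distrib_right)
  finally show ?thesis using assms by (simp add: unit_marginals_def)
qed

lemma entropic_ot_cost_excess:
  fixes A X S :: "real^'n^'n"
  assumes A: "\<And>i j. A $ i $ j > 0"
    and p: "\<And>i. p i > 0" and q: "\<And>j. q j > 0"
    and S: "\<And>i j. S $ i $ j = p i * A $ i $ j * q j"
    and mX: "unit_marginals X" and mS: "unit_marginals S"
  shows "entropic_ot_cost \<alpha> (\<chi> i j. - \<alpha> * ln (A $ i $ j)) X
      - entropic_ot_cost \<alpha> (\<chi> i j. - \<alpha> * ln (A $ i $ j)) S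
    = \<alpha> * (\<Sum>i\<in>UNIV. \<Sum>j\<in>UNIV.
        X $ i $ j * (ln (X $ i $ j) - ln (S $ i $ j)) - X $ i $ j + S $ i $ j)"
    (is "?c X - ?c S = \<alpha> * ?R X")
proof -
  \<comment> \<open>The value of \<open>ln (p i) + ln (q j)\<close> summed against any matrix with
    unit marginals; it cancels when two costs are compared.\<close>
  define K where "K = (\<Sum>i\<in>UNIV. ln (p i)) + (\<Sum>j\<in>UNIV. ln (q j))"
  have lnS: "ln (S $ i $ j) = ln (p i) + ln (q j) + ln (A $ i $ j)" for i j
    using A[of i j] p[of i] q[of j] by (simp add: S ln_mult)
  have cost: "?c Y = \<alpha> * (?R Y + K)" if mY: "unit_marginals Y" for Y
  proof -
    have "(\<Sum>i\<in>UNIV. \<Sum>j\<in>UNIV. Y $ i $ j) = (\<Sum>i\<in>UNIV. \<Sum>j\<in>UNIV. S $ i $ j)"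
      using mY mS by (simp add: unit_marginals_def)
    then have "?R Y + K = (\<Sum>i\<in>UNIV. \<Sum>j\<in>UNIV. Y $ i $ j * (ln (Y $ i $ j) - ln (S $ i $ j)))
        + (\<Sum>i\<in>UNIV. \<Sum>j\<in>UNIV. Y $ i $ j * (ln (p i) + ln (q j)))"
      unfolding sum_additive_unit_marginals[OF mY] K_def
      by (simp add: sum.distrib sum_subtractf)
    also have "\<dots> = (\<Sum>i\<in>UNIV. \<Sum>j\<in>UNIV. Y $ i $ j * (ln (Y $ i $ j) - ln (A $ i $ j)))"
      unfolding sum.distrib[symmetric] lnS by (simp add: algebra_simps)
    finally show ?thesis
      unfolding entropic_ot_cost_def by (simp add: sum_distrib_left algebra_simps)
  qed
  have "?R S = 0" by simp
  then show ?thesis using cost[OF mX] cost[OF mS] by (simp add: algebra_simps)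
qed

text \<open>The excess cost over \<open>S\<close> is a positive multiple of a sum of nonnegative
  terms that vanish only where the entries agree. As the scaling is arbitrary, this also shows that
  two scalings of \<open>A\<close> have the same \<open>S\<close>.\<close>

theorem entropic_ot_solution_iff_sinkhorn:
  fixes A :: "real^'n^'n"
  assumes A: "\<And>i j. A $ i $ j > 0" and "\<alpha> > 0"
    and "sinkhorn_scaling A D1 D2 S"
  shows "entropic_ot_solution \<alpha> (\<chi> i j. - \<alpha> * ln (A $ i $ j)) X \<longleftrightarrow> X = S"
proof -
  let ?c = "entropic_ot_cost \<alpha> (\<chi> i j. - \<alpha> * ln (A $ i $ j))"
  let ?r = "\<lambda>Y i j. Y $ i $ j * (ln (Y $ i $ j) - ln (S $ i $ j)) - Y $ i $ j + S $ i $ j"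
  have D: "\<And>i. D1 $ i $ i > 0" "\<And>i. D2 $ i $ i > 0" and mS: "unit_marginals S"
    and nth: "S $ i $ j = D1 $ i $ i * A $ i $ j * D2 $ j $ j" for i j
    using assms(3) diagonal_matrix_mult_nth[of D1 D2 A i j]
    by (auto simp: sinkhorn_scaling_def positive_diagonal_matrix_def doubly_stochastic_def)
  \<comment> \<open>Double stochasticity gives only nonnegative entries; feasibility and the
    logarithms need the strict positivity of the three factors.\<close>
  have Spos: "S $ i $ j > 0" for i j using A D by (simp add: nth)
  have S: "entropic_ot_feasible S" using Spos mS by (simp add: entropic_ot_feasible_def)
  have excess: "?c Y - ?c S = \<alpha> * (\<Sum>i\<in>UNIV. \<Sum>j\<in>UNIV. ?r Y i j)"
    and r: "0 \<le> ?r Y i j" "?r Y i j = 0 \<Longrightarrow> Y $ i $ j = S $ i $ j"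
    if "entropic_ot_feasible Y" for Y i j
    using that entropic_ot_cost_excess[OF A D nth _ mS, of Y \<alpha>]
      relative_entropy_term_nonneg[OF _ Spos]
    by (auto simp: entropic_ot_feasible_def)
  have min: "?c S \<le> ?c Y" if "entropic_ot_feasible Y" for Y
  proof -
    have "0 \<le> \<alpha> * (\<Sum>i\<in>UNIV. \<Sum>j\<in>UNIV. ?r Y i j)"
      using \<open>\<alpha> > 0\<close> by (intro mult_nonneg_nonneg sum_nonneg r(1)[OF that]) simp
    then show ?thesis using excess[OF that] by linarith
  qed
  have unique: "Y = S" if Y: "entropic_ot_feasible Y" and "?c Y \<le> ?c S" for Y
  proof -
    have "(\<Sum>i\<in>UNIV. \<Sum>j\<in>UNIV. ?r Y i j) = 0"
      using excess[OF Y] min[OF Y] that(2) \<open>\<alpha> > 0\<close> by simp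
    then have "?r Y i j = 0" for i j
      using r(1)[OF Y] by (simp add: sum_nonneg_eq_0_iff sum_nonneg)
    then show ?thesis using r(2)[OF Y] by (simp add: vec_eq_iff)
  qed
  show ?thesis
    unfolding entropic_ot_solution_def is_arg_min_def
    using S min unique by (metis linorder_not_less)
qed

text \<open>The existence conjunct keeps the equivalence from being vacuous; together they give a
  minimizer and its uniqueness. All scalings are quantified over because the diagonal factors are
  determined only up to reciprocal constants.\<close>

theorem proposition9:
  fixes A C :: "real^'n^'n" and \<alpha> :: real
  assumes "A \<in> pairwise_comparison_matrices"
    and "\<alpha> > 0"
    and "C = (\<chi> i j. - \<alpha> * ln (A $ i $ j))"
  shows "(\<exists>D1 D2 S. sinkhorn_scaling A D1 D2 S) \<and>
    (\<forall>D1 D2 S X. sinkhorn_scaling A D1 D2 S \<longrightarrow>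
       (entropic_ot_solution \<alpha> C X \<longleftrightarrow> X = S))"
proof -
  have A: "\<And>i j. A $ i $ j > 0"
    using assms(1) unfolding pairwise_comparison_matrices_def by blast
  show ?thesis
    unfolding assms(3)
    by (intro conjI allI impI sinkhorn_scaling_exists[OF A]
        entropic_ot_solution_iff_sinkhorn[OF A assms(2)])
qed

end
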